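(* The dual space of $\ell_{\theta(1)}$ is $\ell_{\theta(\infty)}$; that is, the space of bounded linear functionals on $\ell_{\theta(1)}$ with the operator norm is isometrically isomorphic to $\ell_{\theta(\infty)}$.
   Context: Let $S,T$ be compact (Hausdorff) spaces, let $C(S)$, $C(T)$ be the spaces of real-valued continuous functions on them, and let $\omega: C(S)\times C(T)\to\mathbb{R}$ be a bounded bilinear form. Fix sequences $(\alpha_k)_{k\in\mathbb{N}}$ in $C(S)$ and $(\beta_k)_{k\in\mathbb{N}}$ in $C(T)$; the same data are used for both spaces below. The space $\ell_{\theta(1)}$ is the $\theta$-Lebesgue sequence space with exponent $1$: the vector space (coordinatewise operations) of all real sequences of the form $\mathbf{x}=\{\omega(\alpha_k,\beta_k)x_k\}_{k\in\mathbb{N}}$, with $x_k\in\mathbb{R}$, such that $\sum_{k=1}^{\infty}|\omega(\alpha_k,\beta_k)x_k|<\infty$, with norm $\|\mathbf{x}\|=\sum_{k=1}^{\infty}|\omega(\alpha_k,\beta_k)x_k|$. The space $\ell_{\theta(\infty)}$ is the vector space of all bounded real sequences of the form $\mathbf{x}=\{\omega(\alpha_k,\beta_k)x_k\}_{k\in\mathbb{N}}$, with $x_k\in\mathbb{R}$, with norm $\|\mathbf{x}\|_{\ell_{\theta(\infty)}}=\sup_{k\in\mathbb{N}}|\omega(\alpha_k,\beta_k)x_k|$. *)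

theory Defs
  imports "HOL-Analysis.Analysis" "HOL-Library.Function_Algebras"
begin

text \<open>
  Pointwise real vector space structure on functions. It is used for sequences
  (\<open>nat \<Rightarrow> real\<close>) and for functionals on sequences (\<open>(nat \<Rightarrow> real) \<Rightarrow> real\<close>).
\<close>

instantiation "fun" :: (type, real_vector) real_vector
begin

definition scaleR_fun :: "real \<Rightarrow> ('a \<Rightarrow> 'b) \<Rightarrow> 'a \<Rightarrow> 'b"
  where "scaleR_fun c f = (\<lambda>x. c *\<^sub>R f x)"

instance
  by standard (simp_all add: scaleR_fun_def fun_eq_iff scaleR_add_left scaleR_add_right)

end

text \<open>
  A normed space is given by a subspace \<open>V\<close> of an ambient real vector space together
  with a norm \<open>N\<close>, of which only the values on \<open>V\<close> matter. A functional on \<open>V\<close> is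
  represented by its extension by \<open>0\<close> to the ambient space; this extension need not be
  linear there, and it makes equality of functionals agree with equality on \<open>V\<close>.
\<close>

definition dual_space :: "'a::real_vector set \<Rightarrow> ('a \<Rightarrow> real) \<Rightarrow> ('a \<Rightarrow> real) set"
  where "dual_space V N =
    {f. (\<forall>x\<in>V. \<forall>y\<in>V. f (x + y) = f x + f y) \<and>
        (\<forall>c. \<forall>x\<in>V. f (c *\<^sub>R x) = c * f x) \<and>
        (\<exists>K. \<forall>x\<in>V. \<bar>f x\<bar> \<le> K * N x) \<and>
        (\<forall>x. x \<notin> V \<longrightarrow> f x = 0)}"

text \<open>
  The relative version of \<open>onorm\<close>; the vector \<open>0\<close> contributes the quotient \<open>0 / 0 = 0\<close>,
  so the supremum is over a nonempty set of nonnegative numbers.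
\<close>

definition dual_norm :: "'a::real_vector set \<Rightarrow> ('a \<Rightarrow> real) \<Rightarrow> ('a \<Rightarrow> real) \<Rightarrow> real"
  where "dual_norm V N f = (SUP x\<in>V. \<bar>f x\<bar> / N x)"

definition isometrically_isomorphic ::
    "'a::real_vector set \<Rightarrow> ('a \<Rightarrow> real) \<Rightarrow> 'b::real_vector set \<Rightarrow> ('b \<Rightarrow> real) \<Rightarrow> bool"
  where "isometrically_isomorphic V N W M \<longleftrightarrow>
    (\<exists>\<Phi>. bij_betw \<Phi> V W \<and>
         (\<forall>x\<in>V. \<forall>y\<in>V. \<Phi> (x + y) = \<Phi> x + \<Phi> y) \<and>
         (\<forall>c. \<forall>x\<in>V. \<Phi> (c *\<^sub>R x) = c *\<^sub>R \<Phi> x) \<and>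
         (\<forall>x\<in>V. M (\<Phi> x) = N x))"

text \<open>
  The elements of the sequence spaces are the sequences \<open>y k = \<omega> (\<alpha> k) (\<beta> k) * x k\<close>
  themselves (not the coefficients \<open>x\<close>, which \<open>y\<close> does not determine where
  \<open>\<omega> (\<alpha> k) (\<beta> k) = 0\<close>), so the norms are functions of \<open>y\<close>. Sequences are indexed from \<open>0\<close>.
\<close>

definition l_theta_1 :: "('a \<Rightarrow> 'b \<Rightarrow> real) \<Rightarrow> (nat \<Rightarrow> 'a) \<Rightarrow> (nat \<Rightarrow> 'b) \<Rightarrow> (nat \<Rightarrow> real) set"
  where "l_theta_1 \<omega> \<alpha> \<beta> =
    {y. (\<exists>x. y = (\<lambda>k. \<omega> (\<alpha> k) (\<beta> k) * x k)) \<and> summable (\<lambda>k. \<bar>y k\<bar>)}"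

definition norm_1 :: "(nat \<Rightarrow> real) \<Rightarrow> real"
  where "norm_1 y = (\<Sum>k. \<bar>y k\<bar>)"

definition l_theta_inf :: "('a \<Rightarrow> 'b \<Rightarrow> real) \<Rightarrow> (nat \<Rightarrow> 'a) \<Rightarrow> (nat \<Rightarrow> 'b) \<Rightarrow> (nat \<Rightarrow> real) set"
  where "l_theta_inf \<omega> \<alpha> \<beta> =
    {y. (\<exists>x. y = (\<lambda>k. \<omega> (\<alpha> k) (\<beta> k) * x k)) \<and> bounded (range y)}"

definition norm_inf :: "(nat \<Rightarrow> real) \<Rightarrow> real"
  where "norm_inf y = (SUP k. \<bar>y k\<bar>)"

lemma subspace_theta_form: "subspace {y. \<exists>x. y = (\<lambda>k. w k * x k)}" for w :: "nat \<Rightarrow> real"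
proof (rule subspaceI)
  show "0 \<in> {y. \<exists>x. y = (\<lambda>k. w k * x k)}"
    by (auto simp: fun_eq_iff intro!: exI[of _ "\<lambda>_. 0"])
next
  fix y z assume "y \<in> {y. \<exists>x. y = (\<lambda>k. w k * x k)}" "z \<in> {y. \<exists>x. y = (\<lambda>k. w k * x k)}"
  then obtain u v where "y = (\<lambda>k. w k * u k)" "z = (\<lambda>k. w k * v k)" by auto
  then show "y + z \<in> {y. \<exists>x. y = (\<lambda>k. w k * x k)}"
    by (auto simp: fun_eq_iff distrib_left intro!: exI[of _ "\<lambda>k. u k + v k"])
next
  fix c y assume "y \<in> {y. \<exists>x. y = (\<lambda>k. w k * x k)}"
  then obtain u where "y = (\<lambda>k. w k * u k)" by auto
  then show "c *\<^sub>R y \<in> {y. \<exists>x. y = (\<lambda>k. w k * x k)}"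
    by (auto simp: fun_eq_iff scaleR_fun_def intro!: exI[of _ "\<lambda>k. c * u k"])
qed

lemma subspace_l_theta_1: "subspace (l_theta_1 \<omega> \<alpha> \<beta>)"
proof -
  have "subspace {y :: nat \<Rightarrow> real. summable (\<lambda>k. \<bar>y k\<bar>)}"
  proof (rule subspaceI)
    fix y z :: "nat \<Rightarrow> real"
    assume "y \<in> {y. summable (\<lambda>k. \<bar>y k\<bar>)}" "z \<in> {y. summable (\<lambda>k. \<bar>y k\<bar>)}"
    then have "summable (\<lambda>k. \<bar>y k\<bar> + \<bar>z k\<bar>)" by (auto intro: summable_add)
    then show "y + z \<in> {y. summable (\<lambda>k. \<bar>y k\<bar>)}"
      by (auto intro: summable_comparison_test' simp: abs_triangle_ineq)
  qed (auto simp: scaleR_fun_def abs_mult intro: summable_mult)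
  then have "subspace ({y. \<exists>x. y = (\<lambda>k. \<omega> (\<alpha> k) (\<beta> k) * x k)} \<inter> {y. summable (\<lambda>k. \<bar>y k\<bar>)})"
    by (intro subspace_inter subspace_theta_form)
  then show ?thesis by (simp add: l_theta_1_def Collect_conj_eq)
qed

lemma subspace_l_theta_inf: "subspace (l_theta_inf \<omega> \<alpha> \<beta>)"
proof -
  have "subspace {y :: nat \<Rightarrow> real. bounded (range y)}"
  proof (rule subspaceI)
    fix y z :: "nat \<Rightarrow> real"
    assume "y \<in> {y. bounded (range y)}" "z \<in> {y. bounded (range y)}"
    then show "y + z \<in> {y. bounded (range y)}"
      by (auto simp: plus_fun_def intro: bounded_plus_comp)
  next
    fix c and y :: "nat \<Rightarrow> real"
    assume "y \<in> {y. bounded (range y)}"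
    then show "c *\<^sub>R y \<in> {y. bounded (range y)}"
      using bounded_scaleR_comp[of y UNIV c] by (simp add: scaleR_fun_def)
  qed (auto simp: zero_fun_def)
  then have "subspace ({y. \<exists>x. y = (\<lambda>k. \<omega> (\<alpha> k) (\<beta> k) * x k)} \<inter> {y. bounded (range y)})"
    by (intro subspace_inter subspace_theta_form)
  then show ?thesis by (simp add: l_theta_inf_def Collect_conj_eq)
qed

end

theory Submission
  imports Defs
begin

text \<open>
  As for \<open>\<ell>\<^sup>1\<close> and \<open>\<ell>\<^sup>\<infinity>\<close>, a functional is sent to its values on the unit sequences. Dividing by
  \<open>\<omega> (\<alpha> k) (\<beta> k)\<close> where possible, the sequences of the form \<open>k \<mapsto> \<omega> (\<alpha> k) (\<beta> k) * x k\<close> are those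
  that vanish wherever \<open>\<omega> (\<alpha> k) (\<beta> k) = 0\<close>. The unit sequences at such \<open>k\<close> lie outside \<open>\<ell>\<^bsub>\<theta>(1)\<^esub>\<close>,
  where functionals are \<open>0\<close> by convention, so the image has the right support without any case
  distinction in the definition of the isometry.
\<close>

abbreviation unit_seq :: "nat \<Rightarrow> nat \<Rightarrow> real"
  where "unit_seq k \<equiv> (\<lambda>j. if j = k then 1 else 0)"

section \<open>Membership, norms and the pairing of the two sequence spaces\<close>

lemma ex_multiple_iff:
  fixes w y :: "nat \<Rightarrow> real"
  shows "(\<exists>x. y = (\<lambda>k. w k * x k)) \<longleftrightarrow> (\<forall>k. w k = 0 \<longrightarrow> y k = 0)"
proof
  assume "\<forall>k. w k = 0 \<longrightarrow> y k = 0"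
  then have "y = (\<lambda>k. w k * (y k / w k))" by auto
  then show "\<exists>x. y = (\<lambda>k. w k * x k)" by (intro exI[of _ "\<lambda>k. y k / w k"])
qed auto

lemma mem_l_theta_1_iff:
  "y \<in> l_theta_1 \<omega> \<alpha> \<beta> \<longleftrightarrow> (\<forall>k. \<omega> (\<alpha> k) (\<beta> k) = 0 \<longrightarrow> y k = 0) \<and> summable (\<lambda>k. \<bar>y k\<bar>)"
  by (simp add: l_theta_1_def ex_multiple_iff)

lemma mem_l_theta_inf_iff:
  "y \<in> l_theta_inf \<omega> \<alpha> \<beta> \<longleftrightarrow> (\<forall>k. \<omega> (\<alpha> k) (\<beta> k) = 0 \<longrightarrow> y k = 0) \<and> bounded (range y)"
  by (simp add: l_theta_inf_def ex_multiple_iff)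

lemma unit_seq_mem_l_theta_1_iff: "unit_seq k \<in> l_theta_1 \<omega> \<alpha> \<beta> \<longleftrightarrow> \<omega> (\<alpha> k) (\<beta> k) \<noteq> 0"
proof -
  have "summable (\<lambda>j. \<bar>unit_seq k j\<bar>)"
    by (rule summable_finite[of "{k}"]) auto
  then show ?thesis by (auto simp: mem_l_theta_1_iff)
qed

lemma norm_1_unit_seq: "norm_1 (unit_seq k) = 1"
  unfolding norm_1_def by (subst suminf_finite[of "{k}"]) auto

lemma norm_1_nonneg: "\<forall>y\<in>l_theta_1 \<omega> \<alpha> \<beta>. norm_1 y \<ge> 0"
  by (simp add: norm_1_def mem_l_theta_1_iff suminf_nonneg)

lemma abs_le_norm_inf:
  assumes "bounded (range a)"
  shows "\<bar>a k\<bar> \<le> norm_inf a"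
  unfolding norm_inf_def
proof (rule cSUP_upper)
  show "bdd_above (range (\<lambda>k. \<bar>a k\<bar>))"
    using assms by (auto simp: bounded_iff bdd_above_def)
qed simp

lemma
  assumes "bounded (range a)" and "summable (\<lambda>k. \<bar>x k\<bar>)"
  shows summable_pairing: "summable (\<lambda>k. a k * x k)"
    and abs_pairing_le: "\<bar>\<Sum>k. a k * x k\<bar> \<le> norm_inf a * norm_1 x"
proof -
  have le: "\<bar>a k * x k\<bar> \<le> norm_inf a * \<bar>x k\<bar>" for k
    by (simp add: abs_mult mult_right_mono abs_le_norm_inf[OF assms(1)])
  have sm: "summable (\<lambda>k. norm_inf a * \<bar>x k\<bar>)"
    using assms(2) by (rule summable_mult)
  have abs: "summable (\<lambda>k. \<bar>a k * x k\<bar>)"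
    by (rule summable_comparison_test'[OF sm, of 0]) (use le in auto)
  then show "summable (\<lambda>k. a k * x k)"
    by (rule summable_rabs_cancel)
  have "\<bar>\<Sum>k. a k * x k\<bar> \<le> (\<Sum>k. \<bar>a k * x k\<bar>)"
    by (rule summable_rabs[OF abs])
  also have "\<dots> \<le> (\<Sum>k. norm_inf a * \<bar>x k\<bar>)"
    by (rule suminf_le[OF le abs sm])
  also have "\<dots> = norm_inf a * norm_1 x"
    by (simp add: norm_1_def suminf_mult[OF assms(2)])
  finally show "\<bar>\<Sum>k. a k * x k\<bar> \<le> norm_inf a * norm_1 x" .
qed

section \<open>Dual norms over an arbitrary subset with a nonnegative \<open>N\<close>\<close>

lemma
  assumes f: "f \<in> dual_space V N" and N: "\<forall>x\<in>V. N x \<ge> 0" and x: "x \<in> V"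
  shows abs_le_dual_norm_mult: "\<bar>f x\<bar> \<le> dual_norm V N f * N x"
    and dual_norm_nonneg: "dual_norm V N f \<ge> 0"
proof -
  from f obtain K where K: "\<And>y. y \<in> V \<Longrightarrow> \<bar>f y\<bar> \<le> K * N y"
    unfolding dual_space_def by blast
  \<comment> \<open>The bound is \<open>\<bar>K\<bar>\<close> because \<open>K\<close> may be
    negative if \<open>N\<close> vanishes on \<open>V\<close>, while the quotient is then
    \<open>0\<close>.\<close>
  have "\<bar>f y\<bar> / N y \<le> \<bar>K\<bar>" if "y \<in> V" for y
  proof (cases "N y = 0")
    case False
    with N that have "N y \<ge> 0" and "N y \<noteq> 0" by auto
    then have "N y > 0" by simp
    with K[OF that] have "\<bar>f y\<bar> / N y \<le> K" by (simp add: field_simps)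
    then show ?thesis by simp
  qed simp
  then have "bdd_above ((\<lambda>y. \<bar>f y\<bar> / N y) ` V)" by (auto simp: bdd_above_def)
  then have le: "\<bar>f x\<bar> / N x \<le> dual_norm V N f"
    unfolding dual_norm_def by (rule cSUP_upper[OF x])
  show "dual_norm V N f \<ge> 0"
    by (rule order_trans[OF _ le]) (use N x in simp)
  show "\<bar>f x\<bar> \<le> dual_norm V N f * N x"
  proof (cases "N x = 0")
    case True
    \<comment> \<open>The quotient \<open>\<bar>f x\<bar> / 0 = 0\<close> carries no information
      here; it is the bound by \<open>K\<close> that forces \<open>f x = 0\<close>.\<close>
    with K[OF x] show ?thesis by simp
  next
    case False
    with N x have "N x \<ge> 0" and "N x \<noteq> 0" by auto
    then have "N x > 0" by simp
    with le show ?thesis by (simp add: field_simps)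
  qed
qed

lemma dual_norm_le:
  assumes "V \<noteq> {}" and "C \<ge> 0" and "\<forall>x\<in>V. N x \<ge> 0"
    and "\<And>x. x \<in> V \<Longrightarrow> \<bar>f x\<bar> \<le> C * N x"
  shows "dual_norm V N f \<le> C"
  unfolding dual_norm_def
proof (rule cSUP_least[OF assms(1)])
  fix x assume x: "x \<in> V"
  \<comment> \<open>For \<open>N x = 0\<close> the quotient is \<open>0\<close>, and the claim
    reduces to \<open>C \<ge> 0\<close>.\<close>
  show "\<bar>f x\<bar> / N x \<le> C"
    using assms(2) bspec[OF assms(3) x] assms(4)[OF x]
    by (cases "N x = 0") (auto simp: divide_le_eq)
qed

section \<open>Expansion of functionals along the unit sequences\<close>

text \<open>A truncation is a finite combination of unit sequences. Membership is carried through
  the induction because \<open>f\<close> is additive only on the space itself.\<close>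

lemma dual_l_theta_1_truncation:
  assumes f: "f \<in> dual_space (l_theta_1 \<omega> \<alpha> \<beta>) norm_1" and x: "x \<in> l_theta_1 \<omega> \<alpha> \<beta>"
  shows "(\<lambda>k. if k < n then x k else 0) \<in> l_theta_1 \<omega> \<alpha> \<beta> \<and>
         f (\<lambda>k. if k < n then x k else 0) = (\<Sum>k<n. f (unit_seq k) * x k)"
proof (induction n)
  case 0
  have mem: "0 \<in> l_theta_1 \<omega> \<alpha> \<beta>" using subspace_l_theta_1 by (rule subspace_0)
  have "\<forall>c. \<forall>y\<in>l_theta_1 \<omega> \<alpha> \<beta>. f (c *\<^sub>R y) = c * f y"
    using f by (simp add: dual_space_def)
  with mem have "f (0 *\<^sub>R 0) = 0" by (metis mult_zero_left)
  with mem show ?case by (simp add: zero_fun_def)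
next
  case (Suc n)
  let ?V = "l_theta_1 \<omega> \<alpha> \<beta>" and ?t = "\<lambda>k. if k < n then x k else 0"
  \<comment> \<open>Where the weight vanishes, \<open>unit_seq n\<close> is outside the space and
    homogeneity does not apply to it; but there \<open>x n = 0\<close>, so the multiple is the zero
    sequence.\<close>
  have scale: "x n *\<^sub>R unit_seq n \<in> ?V \<and> f (x n *\<^sub>R unit_seq n) = f (unit_seq n) * x n"
  proof (cases "\<omega> (\<alpha> n) (\<beta> n) = 0")
    case True
    with x have "x n = 0" by (simp add: mem_l_theta_1_iff)
    moreover have "f 0 = 0" and "0 \<in> ?V"
    proof -
      show "0 \<in> ?V" using subspace_l_theta_1 by (rule subspace_0)
      then show "f 0 = 0" using f unfolding dual_space_def
        by (metis (mono_tags, lifting) mem_Collect_eq mult_zero_left scaleR_zero_left)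
    qed
    ultimately show ?thesis by simp
  next
    case False
    then have e: "unit_seq n \<in> ?V" by (simp only: unit_seq_mem_l_theta_1_iff not_False_eq_True)
    then show ?thesis
      using f subspace_scale[OF subspace_l_theta_1 e] by (auto simp: dual_space_def)
  qed
  have split: "(\<lambda>k. if k < Suc n then x k else 0) = ?t + x n *\<^sub>R unit_seq n"
    by (auto simp: fun_eq_iff scaleR_fun_def less_Suc_eq)
  have add: "\<forall>y\<in>?V. \<forall>z\<in>?V. f (y + z) = f y + f z"
    using f by (simp add: dual_space_def)
  have "?t + x n *\<^sub>R unit_seq n \<in> ?V"
    using Suc scale by (intro subspace_add[OF subspace_l_theta_1]) auto
  then show ?case
    unfolding split using Suc scale add by simp
qed

text \<open>The truncations of \<open>x\<close> converge to \<open>x\<close> in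
  \<open>norm_1\<close>, and the boundedness of \<open>f\<close> carries this convergence over to
  the values.\<close>

lemma dual_l_theta_1_sums:
  assumes f: "f \<in> dual_space (l_theta_1 \<omega> \<alpha> \<beta>) norm_1" and x: "x \<in> l_theta_1 \<omega> \<alpha> \<beta>"
  shows "(\<lambda>k. f (unit_seq k) * x k) sums f x"
proof -
  let ?V = "l_theta_1 \<omega> \<alpha> \<beta>" and ?t = "\<lambda>n k. if k < n then x k else 0"
  have s: "summable (\<lambda>k. \<bar>x k\<bar>)" using x by (simp add: mem_l_theta_1_iff)
  have t: "?t n \<in> ?V" "f (?t n) = (\<Sum>k<n. f (unit_seq k) * x k)" for n
    using dual_l_theta_1_truncation[OF assms] by auto
  have d: "x - ?t n \<in> ?V" for n
    by (rule subspace_diff[OF subspace_l_theta_1 x t(1)])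
  have diff: "f x - (\<Sum>k<n. f (unit_seq k) * x k) = f (x - ?t n)" for n
  proof -
    have "f ((x - ?t n) + ?t n) = f (x - ?t n) + f (?t n)"
      using f d[of n] t(1)[of n] unfolding dual_space_def by blast
    then show ?thesis by (simp only: diff_add_cancel t(2) add_diff_cancel_right')
  qed
  \<comment> \<open>The difference vanishes below \<open>n\<close> and agrees with \<open>x\<close>
    from \<open>n\<close> on, so its norm is a tail of the series for
    \<open>norm_1 x\<close>.\<close>
  have norm: "norm_1 (x - ?t n) = norm_1 x - (\<Sum>k<n. \<bar>x k\<bar>)" for n
  proof -
    have "summable (\<lambda>k. \<bar>(x - ?t n) k\<bar>)" using d[of n] by (simp only: mem_l_theta_1_iff)
    then have "norm_1 (x - ?t n) =
        (\<Sum>k. \<bar>(x - ?t n) (k + n)\<bar>) + (\<Sum>k<n. \<bar>(x - ?t n) k\<bar>)"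
      unfolding norm_1_def by (rule suminf_split_initial_segment)
    also have "\<dots> = (\<Sum>k. \<bar>x (k + n)\<bar>)" by simp
    finally show ?thesis
      using suminf_split_initial_segment[OF s, of n] by (simp add: norm_1_def)
  qed
  obtain K where K: "\<And>y. y \<in> ?V \<Longrightarrow> \<bar>f y\<bar> \<le> K * norm_1 y"
    using f unfolding dual_space_def by blast
  have "(\<lambda>n. \<Sum>k<n. \<bar>x k\<bar>) \<longlonglongrightarrow> norm_1 x"
    using summable_LIMSEQ[OF s] by (simp add: norm_1_def)
  then have lim: "(\<lambda>n. K * (norm_1 x - (\<Sum>k<n. \<bar>x k\<bar>))) \<longlonglongrightarrow> K * (norm_1 x - norm_1 x)"
    by (intro tendsto_intros)
  have "(\<lambda>n. f x - (\<Sum>k<n. f (unit_seq k) * x k)) \<longlonglongrightarrow> 0"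
  proof (rule Lim_null_comparison)
    show "\<forall>\<^sub>F n in sequentially. norm (f x - (\<Sum>k<n. f (unit_seq k) * x k))
        \<le> K * (norm_1 x - (\<Sum>k<n. \<bar>x k\<bar>))"
      using K[OF d] by (simp add: diff norm)
  qed (use lim in simp)
  then have "(\<lambda>n. f x - (f x - (\<Sum>k<n. f (unit_seq k) * x k))) \<longlonglongrightarrow> f x - 0"
    by (intro tendsto_intros)
  then show ?thesis by (simp add: sums_def)
qed

section \<open>The coefficient map: isometry, injectivity, surjectivity\<close>

text \<open>Unit sequences in the space have norm \<open>1\<close>, so the dual norm bounds every
  coefficient; conversely, the expansion of \<open>f x\<close> and the pairing inequality bound the
  dual norm by the supremum of the coefficients.\<close>

lemma
  assumes f: "f \<in> dual_space (l_theta_1 \<omega> \<alpha> \<beta>) norm_1"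
  shows dual_coeffs_mem: "(\<lambda>k. f (unit_seq k)) \<in> l_theta_inf \<omega> \<alpha> \<beta>"
    and norm_inf_dual_coeffs:
      "norm_inf (\<lambda>k. f (unit_seq k)) = dual_norm (l_theta_1 \<omega> \<alpha> \<beta>) norm_1 f"
proof -
  let ?V = "l_theta_1 \<omega> \<alpha> \<beta>" and ?a = "\<lambda>k. f (unit_seq k)"
  have V0: "0 \<in> ?V" using subspace_l_theta_1 by (rule subspace_0)
  have off: "f (unit_seq k) = 0" if "\<omega> (\<alpha> k) (\<beta> k) = 0" for k
    using f that unit_seq_mem_l_theta_1_iff[of k \<omega> \<alpha> \<beta>] unfolding dual_space_def by blast
  have le: "\<bar>?a k\<bar> \<le> dual_norm ?V norm_1 f" for k
  proof (cases "\<omega> (\<alpha> k) (\<beta> k) = 0")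
    \<comment> \<open>The unit sequence is outside the space, so the coefficient is \<open>0\<close>
      and only nonnegativity of the dual norm is needed.\<close>
    case True
    then show ?thesis using dual_norm_nonneg[OF f norm_1_nonneg V0] off by simp
  next
    case False
    then have "unit_seq k \<in> ?V" by (simp only: unit_seq_mem_l_theta_1_iff not_False_eq_True)
    from abs_le_dual_norm_mult[OF f norm_1_nonneg this] show ?thesis
      by (simp only: norm_1_unit_seq mult_1_right)
  qed
  have bdd: "bounded (range ?a)"
    using le by (auto simp: bounded_iff)
  with off show "?a \<in> l_theta_inf \<omega> \<alpha> \<beta>" by (simp add: mem_l_theta_inf_iff)
  show "norm_inf ?a = dual_norm ?V norm_1 f"
  proof (rule antisym)
    show "norm_inf ?a \<le> dual_norm ?V norm_1 f"
      unfolding norm_inf_def by (rule cSUP_least) (use le in auto)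
    show "dual_norm ?V norm_1 f \<le> norm_inf ?a"
    proof (rule dual_norm_le)
      show "norm_inf ?a \<ge> 0"
        using abs_le_norm_inf[OF bdd, of 0] by simp
      fix x assume x: "x \<in> ?V"
      then have "summable (\<lambda>k. \<bar>x k\<bar>)" by (simp add: mem_l_theta_1_iff)
      from abs_pairing_le[OF bdd this] show "\<bar>f x\<bar> \<le> norm_inf ?a * norm_1 x"
        by (simp add: sums_unique[OF dual_l_theta_1_sums[OF f x]])
    qed (use V0 norm_1_nonneg in auto)
  qed
qed

text \<open>Injectivity: the expansion determines the values on the space, and the extension by
  \<open>0\<close> those outside it.\<close>

lemma dual_l_theta_1_eqI:
  assumes f: "f \<in> dual_space (l_theta_1 \<omega> \<alpha> \<beta>) norm_1"
    and g: "g \<in> dual_space (l_theta_1 \<omega> \<alpha> \<beta>) norm_1"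
    and eq: "\<And>k. f (unit_seq k) = g (unit_seq k)"
  shows "f = g"
proof
  fix x show "f x = g x"
  proof (cases "x \<in> l_theta_1 \<omega> \<alpha> \<beta>")
    case True
    with dual_l_theta_1_sums[OF f True] dual_l_theta_1_sums[OF g True] show ?thesis
      by (simp add: eq sums_unique2)
  next
    case False
    with f g show ?thesis by (simp add: dual_space_def)
  qed
qed

text \<open>Surjectivity: pairing with \<open>a\<close> gives the functional, and the pairing
  inequality its boundedness.\<close>

lemma ex_dual_with_coeffs:
  assumes a: "a \<in> l_theta_inf \<omega> \<alpha> \<beta>"
  shows "\<exists>f\<in>dual_space (l_theta_1 \<omega> \<alpha> \<beta>) norm_1. (\<lambda>k. f (unit_seq k)) = a"
proof -
  let ?V = "l_theta_1 \<omega> \<alpha> \<beta>"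
  define f where "f x = (if x \<in> ?V then \<Sum>k. a k * x k else 0)" for x
  have bdd: "bounded (range a)" and off: "\<And>k. \<omega> (\<alpha> k) (\<beta> k) = 0 \<Longrightarrow> a k = 0"
    using a by (auto simp: mem_l_theta_inf_iff)
  have V: "summable (\<lambda>k. \<bar>x k\<bar>)" if "x \<in> ?V" for x
    using that by (simp add: mem_l_theta_1_iff)
  note pair = summable_pairing[OF bdd V]
  have "f (x + y) = f x + f y" if x: "x \<in> ?V" and y: "y \<in> ?V" for x y
    using x y subspace_add[OF subspace_l_theta_1 x y] suminf_add[OF pair[OF x] pair[OF y]]
    by (simp add: f_def distrib_left)
  moreover have "f (c *\<^sub>R x) = c * f x" if x: "x \<in> ?V" for c x
    using x subspace_scale[OF subspace_l_theta_1 x, of c] suminf_mult[OF pair[OF x], of c]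
    by (simp add: f_def scaleR_fun_def mult.left_commute)
  moreover have "\<bar>f x\<bar> \<le> norm_inf a * norm_1 x" if x: "x \<in> ?V" for x
    using abs_pairing_le[OF bdd V[OF x]] x by (simp add: f_def)
  moreover have "f x = 0" if "x \<notin> ?V" for x
    using that by (simp add: f_def)
  ultimately have "f \<in> dual_space ?V norm_1"
    unfolding dual_space_def by blast
  moreover have "f (unit_seq k) = a k" for k
  proof (cases "\<omega> (\<alpha> k) (\<beta> k) = 0")
    \<comment> \<open>Here \<open>f\<close> takes its default value \<open>0\<close>, which equals
      \<open>a k\<close> because \<open>a\<close> vanishes with the weights.\<close>
    case True
    then show ?thesis using off unit_seq_mem_l_theta_1_iff[of k \<omega> \<alpha> \<beta>] by (simp add: f_def)
  next
    case False
    then have "unit_seq k \<in> ?V" by (simp only: unit_seq_mem_l_theta_1_iff not_False_eq_True)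
    moreover have "(\<Sum>j. a j * unit_seq k j) = a k"
      by (subst suminf_finite[of "{k}"]) auto
    ultimately show ?thesis by (simp only: f_def if_True)
  qed
  ultimately show ?thesis by blast
qed

theorem theorem8:
  fixes \<omega> :: "('s::t2_space \<Rightarrow>\<^sub>C real) \<Rightarrow> ('t::t2_space \<Rightarrow>\<^sub>C real) \<Rightarrow> real"
    and \<alpha> :: "nat \<Rightarrow> ('s \<Rightarrow>\<^sub>C real)"
    and \<beta> :: "nat \<Rightarrow> ('t \<Rightarrow>\<^sub>C real)"
  assumes "compact (UNIV :: 's set)" and "compact (UNIV :: 't set)"
    and "bounded_bilinear \<omega>"
  shows "isometrically_isomorphic
           (dual_space (l_theta_1 \<omega> \<alpha> \<beta>) norm_1) (dual_norm (l_theta_1 \<omega> \<alpha> \<beta>) norm_1)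
           (l_theta_inf \<omega> \<alpha> \<beta>) norm_inf"
  unfolding isometrically_isomorphic_def
proof (intro exI[of _ "\<lambda>f k. f (unit_seq k)"] conjI allI ballI)
  let ?D = "dual_space (l_theta_1 \<omega> \<alpha> \<beta>) norm_1" and ?\<Phi> = "\<lambda>f k. f (unit_seq k)"
  show "bij_betw ?\<Phi> ?D (l_theta_inf \<omega> \<alpha> \<beta>)"
  proof (rule bij_betw_imageI)
    show "inj_on ?\<Phi> ?D"
      by (rule inj_onI) (erule (1) dual_l_theta_1_eqI, erule fun_cong)
    show "?\<Phi> ` ?D = l_theta_inf \<omega> \<alpha> \<beta>"
      using ex_dual_with_coeffs[of _ \<omega> \<alpha> \<beta>] dual_coeffs_mem[of _ \<omega> \<alpha> \<beta>] by fast
  qed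
\<comment> \<open>Linearity is immediate, since the operations on functionals and on sequences are
  pointwise.\<close>
qed (simp_all add: fun_eq_iff scaleR_fun_def norm_inf_dual_coeffs)

end
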